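(* Let $G=(V,E)$ be a connected graph with radius $r$ and let $1\le c\le |V|$. Then $$M_c(G)\ \le\ (c-1)r .$$
   Context: All graphs are finite and simple. The radius of $G$ is $\min_{u\in V}\max_{w\in V}d(u,w)$, where $d$ is the usual graph distance. The (free) Flood-It game: let $G=(V,E)$ be a graph with a colouring $\omega:V\to C$, not necessarily proper, where $C$ is a finite colour-set. A monochromatic component is a maximal set of vertices of one colour inducing a connected subgraph. A move $(v,d)$, with $v\in V$ and $d\in C$, recolours with colour $d$ every vertex in the monochromatic component (with respect to the current colouring) containing $v$. For $d\in C$, $m(G,\omega,d)$ is the minimum number of moves needed, starting from $\omega$, to give all vertices of $G$ colour $d$, and $m(G,\omega)=\min_{d\in C}m(G,\omega,d)$. For a positive integer $c\le |V|$, $M_c(G)=\max_\omega m(G,\omega)$, where the maximum is over all surjective colourings $\omega:V\to\{1,\dots,c\}$ (with colour-set $C=\{1,\dots,c\}$). *)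

theory Defs
  imports
    "Graph_Theory.Digraph_Component"
    "HOL-Library.Extended_Nat"
    "HOL-Library.FuncSet"
begin

text \<open>
  A finite simple graph is a \<open>graph\<close> in the sense of the digraph library: a finite, loop-free,
  symmetric digraph without parallel arcs, each edge being a pair of opposite arcs.
  A walk is a list of arcs, so its number of edges is its length.
\<close>

definition gdist :: "('a, 'b) pre_digraph \<Rightarrow> 'a \<Rightarrow> 'a \<Rightarrow> enat" where
  "gdist G u v = (INF p \<in> {p. pre_digraph.awalk G u p v}. enat (length p))"

definition radius :: "('a, 'b) pre_digraph \<Rightarrow> enat" where
  "radius G = (MIN u \<in> verts G. MAX w \<in> verts G. gdist G u w)"

text \<open>The library's \<open>connected\<close> is false of the null graph, so the set below is nonempty.\<close>

definition mono_connected :: "('a, 'b) pre_digraph \<Rightarrow> ('a \<Rightarrow> 'c) \<Rightarrow> 'a set \<Rightarrow> bool" where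
  "mono_connected G \<omega> S \<longleftrightarrow>
     S \<subseteq> verts G \<and> (\<forall>x \<in> S. \<forall>y \<in> S. \<omega> x = \<omega> y) \<and> Digraph_Component.connected (G \<restriction> S)"

definition mono_component :: "('a, 'b) pre_digraph \<Rightarrow> ('a \<Rightarrow> 'c) \<Rightarrow> 'a set \<Rightarrow> bool" where
  "mono_component G \<omega> S \<longleftrightarrow>
     mono_connected G \<omega> S \<and> \<not> (\<exists>T. S \<subset> T \<and> mono_connected G \<omega> T)"

text \<open>The component containing a given vertex is unique, so the existential over \<open>S\<close> selects it.\<close>

definition flood_move :: "('a, 'b) pre_digraph \<Rightarrow> 'a \<times> 'c \<Rightarrow> ('a \<Rightarrow> 'c) \<Rightarrow> 'a \<Rightarrow> 'c" where
  "flood_move G = (\<lambda>(v, d) \<omega> u.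
     if \<exists>S. mono_component G \<omega> S \<and> v \<in> S \<and> u \<in> S then d else \<omega> u)"

text \<open>
  The value is \<open>\<infinity>\<close> if no sequence of moves makes the graph monochromatic in colour \<open>d\<close>.
\<close>

definition min_moves_to ::
    "('a, 'b) pre_digraph \<Rightarrow> 'c set \<Rightarrow> ('a \<Rightarrow> 'c) \<Rightarrow> 'c \<Rightarrow> enat" where
  "min_moves_to G C \<omega> d =
     (INF ms \<in> {ms \<in> lists (verts G \<times> C). \<forall>v \<in> verts G. fold (flood_move G) ms \<omega> v = d}.
        enat (length ms))"

definition min_moves :: "('a, 'b) pre_digraph \<Rightarrow> 'c set \<Rightarrow> ('a \<Rightarrow> 'c) \<Rightarrow> enat" where
  "min_moves G C \<omega> = (MIN d \<in> C. min_moves_to G C \<omega> d)"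

definition max_min_moves :: "nat \<Rightarrow> ('a, 'b) pre_digraph \<Rightarrow> enat" where
  "max_min_moves c G =
     (MAX \<omega> \<in> {\<omega> \<in> verts G \<rightarrow>\<^sub>E {1..c}. \<omega> ` verts G = {1..c}}. min_moves G {1..c} \<omega>)"

end

theory Submission
  imports Defs
begin

text \<open>
  Play every move at a centre \<open>u\<close> of the graph. While its monochromatic component contains a set
  \<open>T\<close>, one round of moves through the other \<open>c - 1\<close> colours absorbs every neighbour of \<open>T\<close>: a
  neighbour that has not been absorbed keeps its colour until the round reaches that colour.
  Hence after \<open>k\<close> rounds the component contains the ball of radius \<open>k\<close> about \<open>u\<close>, and \<open>r\<close> rounds
  suffice.
\<close>

text \<open>\<open>connected\<close> is strong connectivity of the symmetric closure. An induced
  subgraph of a symmetric digraph is symmetric, so taking its closure adds no reachability.\<close>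

lemma (in sym_digraph) connected_induce_iff:
  assumes "S \<subseteq> verts G"
  shows "Digraph_Component.connected (G \<restriction> S) \<longleftrightarrow>
    S \<noteq> {} \<and> (\<forall>x\<in>S. \<forall>y\<in>S. x \<rightarrow>\<^sup>*\<^bsub>G \<restriction> S\<^esub> y)"
proof -
  interpret H: sym_digraph "G \<restriction> S"
    using assms by (intro induced_graph_imp_graph induced_induce)
  show ?thesis
    by (simp add: connected_def strongly_connected_def H.reachable_mk_symmetric_eq[OF H.sym_arcs])
qed

text \<open>One vertex \<open>u\<close> of \<open>S\<close> reaches all of \<open>S\<close>, and
  through one more arc all of \<open>N\<close>; that arc survives in the induced subgraph because
  both its ends lie in \<open>S \<union> N\<close>. Symmetry then gives reachability between any two
  vertices.\<close>

lemma (in sym_digraph) connected_induce_Un: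
  assumes conn: "Digraph_Component.connected (G \<restriction> S)" and S: "S \<subseteq> verts G"
    and N: "\<And>v. v \<in> N \<Longrightarrow> v \<in> S \<or> (\<exists>w\<in>S. w \<rightarrow>\<^bsub>G\<^esub> v)"
  shows "Digraph_Component.connected (G \<restriction> (S \<union> N))"
proof -
  have N_verts: "N \<subseteq> verts G"
    using N S adj_in_verts(2) by blast
  let ?H = "G \<restriction> (S \<union> N)"
  interpret H: sym_digraph ?H
    using S N_verts by (intro induced_graph_imp_graph induced_induce) auto
  have nonempty: "S \<noteq> {}" and within: "\<And>x y. x \<in> S \<Longrightarrow> y \<in> S \<Longrightarrow> x \<rightarrow>\<^sup>*\<^bsub>?H\<^esub> y"
    using conn reachable_induce_ss[of S _ _ "S \<union> N"] by (auto simp: connected_induce_iff[OF S])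
  then obtain u where u: "u \<in> S" by blast
  have from_u: "u \<rightarrow>\<^sup>*\<^bsub>?H\<^esub> v" if v: "v \<in> S \<union> N" for v
  proof (cases "v \<in> S")
    case True
    then show ?thesis using within u by blast
  next
    case False
    then obtain w where w: "w \<in> S" "w \<rightarrow>\<^bsub>G\<^esub> v" using v N by blast
    then have "w \<rightarrow>\<^bsub>?H\<^esub> v"
      using v by (auto simp: arcs_ends_conv intro!: rev_image_eqI)
    with within[OF u w(1)] show ?thesis by (rule H.reachable_adj_trans)
  qed
  have "x \<rightarrow>\<^sup>*\<^bsub>?H\<^esub> y" if "x \<in> S \<union> N" "y \<in> S \<union> N" for x y
    using H.symmetric_reachable'[OF from_u[OF that(1)]] from_u[OF that(2)]
    by (rule H.reachable_trans)
  then show ?thesis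
    using nonempty S N_verts by (subst connected_induce_iff) auto
qed

context graph
begin

lemma mono_connected_Un:
  assumes T: "mono_connected G \<omega> T" and u: "u \<in> T"
    and N: "\<And>v. v \<in> N \<Longrightarrow> v \<in> T \<or> (\<exists>w\<in>T. w \<rightarrow>\<^bsub>G\<^esub> v)"
    and colour: "\<And>v. v \<in> N \<Longrightarrow> \<omega> v = \<omega> u"
  shows "mono_connected G \<omega> (T \<union> N)"
proof -
  have "N \<subseteq> verts G"
    using N T adj_in_verts(2) unfolding mono_connected_def by blast
  moreover have "\<omega> x = \<omega> u" if "x \<in> T \<union> N" for x
    using that T u colour unfolding mono_connected_def by blast
  ultimately show ?thesis
    using T N connected_induce_Un[of T N] unfolding mono_connected_def by auto
qed

text \<open>Moves are defined through maximal sets, while the proof tracks sets that are merely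
  \<open>mono_connected\<close>; this is the bridge. All such sets are subsets of the finite
  \<open>verts G\<close>, so each lies in a maximal one.\<close>

lemma mono_component_extends:
  assumes "mono_connected G \<omega> S"
  obtains T where "S \<subseteq> T" "mono_component G \<omega> T"
proof -
  let ?A = "{T. mono_connected G \<omega> T}"
  have "finite ?A"
    by (rule finite_subset[of _ "Pow (verts G)"]) (auto simp: mono_connected_def)
  then obtain T where "T \<in> ?A" "S \<subseteq> T" "\<forall>T'\<in>?A. T \<subseteq> T' \<longrightarrow> T' = T"
    using finite_has_maximal2[of ?A S] assms by auto
  then have "mono_component G \<omega> T"
    unfolding mono_component_def by auto
  with \<open>S \<subseteq> T\<close> show thesis by (rule that)
qed

lemma flood_move_on_mono_connected:
  assumes "mono_connected G \<omega> T" "u \<in> T" "v \<in> T"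
  shows "flood_move G (u, d) \<omega> v = d"
proof -
  obtain S where "T \<subseteq> S" "mono_component G \<omega> S"
    using assms(1) by (rule mono_component_extends)
  then show ?thesis
    using assms(2,3) unfolding flood_move_def by auto
qed

lemma flood_move_mono_connected:
  assumes "mono_connected G \<omega> T" "u \<in> T"
  shows "mono_connected G (flood_move G (u, d) \<omega>) T"
  using assms flood_move_on_mono_connected[OF assms] unfolding mono_connected_def by simp

text \<open>Induction on the remaining colours, with \<open>N\<close> fixed while \<open>T\<close>
  and the colouring vary. The colour condition is confined to \<open>N - T\<close> so that it
  survives dropping \<open>d\<close> from the list: after that move, every vertex of
  \<open>N\<close> outside the enlarged set has a colour other than \<open>d\<close>.\<close>

lemma flood_moves_absorb:
  assumes "mono_connected G \<omega> T" "u \<in> T"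
    and "\<And>v. v \<in> N \<Longrightarrow> v \<in> T \<or> (\<exists>w\<in>T. w \<rightarrow>\<^bsub>G\<^esub> v)"
    and "\<And>v. v \<in> N - T \<Longrightarrow> \<omega> v \<in> set ds"
  shows "mono_connected G (fold (flood_move G) (map (Pair u) ds) \<omega>) (T \<union> N)"
  using assms
proof (induction ds arbitrary: \<omega> T)
  case Nil
  then have "T \<union> N = T" by auto
  with Nil show ?case by simp
next
  case (Cons d ds)
  define \<omega>' where "\<omega>' = flood_move G (u, d) \<omega>"
  \<comment> \<open>Testing the new colouring catches both the vertices of \<open>N\<close> that
    already had colour \<open>d\<close> and those that the move itself recoloured.\<close>
  define T' where "T' = T \<union> {v \<in> N. \<omega>' v = d}"
  have "\<omega>' u = d"
    unfolding \<omega>'_def using Cons.prems(1,2) by (intro flood_move_on_mono_connected)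
  then have "mono_connected G \<omega>' T'"
    unfolding T'_def using Cons.prems
    by (intro mono_connected_Un[where u = u]) (auto simp: \<omega>'_def intro: flood_move_mono_connected)
  moreover have "\<omega>' v \<in> set ds" if "v \<in> N - T'" for v
  proof -
    have "\<omega>' v \<noteq> d" using that by (auto simp: T'_def)
    \<comment> \<open>The move leaves each vertex either coloured \<open>d\<close> or
      untouched.\<close>
    then have "\<omega>' v = \<omega> v"
      unfolding \<omega>'_def flood_move_def by (auto split: if_splits)
    moreover have "\<omega> v \<in> set (d # ds)"
      using that by (intro Cons.prems(4)) (auto simp: T'_def)
    ultimately show ?thesis using \<open>\<omega>' v \<noteq> d\<close> by simp
  qed
  ultimately have "mono_connected G (fold (flood_move G) (map (Pair u) ds) \<omega>') (T' \<union> N)"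
    using Cons.prems(2,3) by (intro Cons.IH) (auto simp: T'_def)
  moreover have "T' \<union> N = T \<union> N" by (auto simp: T'_def)
  ultimately show ?case by (simp add: \<omega>'_def)
qed

text \<open>This allows a new round to start from the colouring left by the previous ones, and puts
  the final colour in \<open>C\<close>.\<close>

lemma fold_flood_move_colours:
  assumes "ms \<in> lists (verts G \<times> C)" "\<omega> ` verts G \<subseteq> C"
  shows "fold (flood_move G) ms \<omega> ` verts G \<subseteq> C"
  using assms
proof (induction ms arbitrary: \<omega>)
  case (Cons m ms)
  then have "flood_move G m \<omega> ` verts G \<subseteq> C"
    by (auto simp: flood_move_def split: prod.splits)
  with Cons show ?case by auto
qed simp

lemma flood_round:
  assumes T: "mono_connected G \<omega> T" "u \<in> T"
    and N: "\<And>v. v \<in> N \<Longrightarrow> v \<in> T \<or> (\<exists>w\<in>T. w \<rightarrow>\<^bsub>G\<^esub> v)"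
    and C: "finite C" "\<omega> ` verts G \<subseteq> C"
  obtains ms where "ms \<in> lists (verts G \<times> C)" "length ms = card C - 1"
    "mono_connected G (fold (flood_move G) ms \<omega>) (T \<union> N)"
proof -
  have T_verts: "T \<subseteq> verts G" using T(1) by (simp add: mono_connected_def)
  have N_verts: "N \<subseteq> verts G" using N T_verts adj_in_verts(2) by blast
  have u_colour: "\<omega> u \<in> C" using C(2) T(2) T_verts by blast
  \<comment> \<open>Omitting the present colour of \<open>u\<close> is what brings the cost of a
    round down to \<open>card C - 1\<close>.\<close>
  have "finite (C - {\<omega> u})" using C(1) by simp
  then obtain ds where ds: "set ds = C - {\<omega> u}" "distinct ds"
    using finite_distinct_list by blast
  \<comment> \<open>The list \<open>ds\<close> misses the colour of \<open>u\<close>, but vertices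
    of \<open>N\<close> with that colour can be joined to \<open>T\<close> before the first
    move.\<close>
  define T' where "T' = T \<union> {v \<in> N. \<omega> v = \<omega> u}"
  have "mono_connected G \<omega> T'"
    unfolding T'_def using T N by (intro mono_connected_Un) auto
  moreover have "\<omega> v \<in> set ds" if "v \<in> N - T'" for v
    using that N_verts C(2) ds(1) by (auto simp: T'_def)
  ultimately have "mono_connected G (fold (flood_move G) (map (Pair u) ds) \<omega>) (T' \<union> N)"
    using T(2) N by (intro flood_moves_absorb) (auto simp: T'_def)
  moreover have "T' \<union> N = T \<union> N" by (auto simp: T'_def)
  moreover have "length ds = card C - 1"
    using distinct_card[OF ds(2)] ds(1) u_colour by (simp add: card_Diff_singleton)
  moreover have "map (Pair u) ds \<in> lists (verts G \<times> C)"
    using ds T(2) T_verts by auto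
  ultimately show thesis using that[of "map (Pair u) ds"] by simp
qed

text \<open>The ball is written with walks instead of \<open>gdist\<close>, so that the induction
  step only has to split off the last arc of a walk.\<close>

lemma flood_rounds_cover_ball:
  assumes u: "u \<in> verts G" and C: "finite C" "\<omega> ` verts G \<subseteq> C"
  obtains ms T where "ms \<in> lists (verts G \<times> C)" "length ms = (card C - 1) * k"
    "mono_connected G (fold (flood_move G) ms \<omega>) T" "u \<in> T"
    "{w. \<exists>p. awalk u p w \<and> length p \<le> k} \<subseteq> T"
proof (induction k arbitrary: thesis)
  case 0
  have "mono_connected G \<omega> {u}"
    using u by (auto simp: mono_connected_def connected_induce_iff reachable_def
        intro: rtrancl_on_refl)
  then show ?case
    using u by (intro 0[of "[]" "{u}"]) (auto simp: awalk_Nil_iff)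
next
  case (Suc k)
  obtain ms T where IH: "ms \<in> lists (verts G \<times> C)" "length ms = (card C - 1) * k"
    "mono_connected G (fold (flood_move G) ms \<omega>) T" "u \<in> T"
    "{w. \<exists>p. awalk u p w \<and> length p \<le> k} \<subseteq> T"
    using Suc.IH by blast
  let ?N = "{w. \<exists>p. awalk u p w \<and> length p \<le> Suc k}"
  have "v \<in> T \<or> (\<exists>w\<in>T. w \<rightarrow>\<^bsub>G\<^esub> v)" if "v \<in> ?N" for v
  proof -
    from that obtain p where p: "awalk u p v" "length p \<le> Suc k" by blast
    show ?thesis
    proof (cases p rule: rev_cases)
      case Nil
      then show ?thesis using p IH(4) by (auto simp: awalk_Nil_iff)
    next
      case (snoc q e)
      with p have "awalk u q (tail G e)" "e \<in> arcs G" "head G e = v"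
        by (auto simp: awalk_simps)
      \<comment> \<open>The walk \<open>q\<close> has length at most \<open>k\<close>, so its end is
        already in \<open>T\<close>.\<close>
      then have "tail G e \<in> T" "tail G e \<rightarrow>\<^bsub>G\<^esub> v"
        using IH(5) p(2) snoc by (auto intro: in_arcs_imp_in_arcs_ends)
      then show ?thesis by blast
    qed
  qed
  moreover have "fold (flood_move G) ms \<omega> ` verts G \<subseteq> C"
    using IH(1) C(2) by (rule fold_flood_move_colours)
  ultimately obtain ns where "ns \<in> lists (verts G \<times> C)" "length ns = card C - 1"
    "mono_connected G (fold (flood_move G) ns (fold (flood_move G) ms \<omega>)) (T \<union> ?N)"
    using flood_round[OF IH(3,4) _ C(1)] by blast
  with IH show ?case
    by (intro Suc.prems[of "ms @ ns" "T \<union> ?N"]) auto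
qed

text \<open>The minimum in \<open>radius\<close> ranges over a finite nonempty set, hence is
  attained, at a centre \<open>u\<close>.\<close>

lemma radius_eqE:
  assumes "verts G \<noteq> {}" "radius G = enat r"
  obtains u where "u \<in> verts G" "\<And>w. w \<in> verts G \<Longrightarrow> \<exists>p. awalk u p w \<and> length p \<le> r"
proof -
  have "radius G \<in> (\<lambda>u. MAX w\<in>verts G. gdist G u w) ` verts G"
    unfolding radius_def using assms(1) by (intro Min_in) auto
  then obtain u where u: "u \<in> verts G" "(MAX w\<in>verts G. gdist G u w) = enat r"
    using assms(2) by auto
  have "\<exists>p. awalk u p w \<and> length p \<le> r" if "w \<in> verts G" for w
  proof -
    have "gdist G u w \<le> enat r"
      using u(2) that by (metis Max_ge finite_imageI finite_verts imageI)
    \<comment> \<open>\<open>INF_less_iff\<close> extracts a walk from a strict bound, hence the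
      passage to \<open>Suc r\<close>; \<open>less_Suc_eq_le\<close> undoes it.\<close>
    then have "gdist G u w < enat (Suc r)"
      by (simp add: le_less_trans)
    then show ?thesis
      unfolding gdist_def by (auto simp: INF_less_iff less_Suc_eq_le)
  qed
  with u(1) show thesis by (rule that)
qed

lemma min_moves_le:
  assumes "verts G \<noteq> {}" "radius G = enat r" and C: "finite C" "\<omega> ` verts G \<subseteq> C"
  shows "min_moves G C \<omega> \<le> enat ((card C - 1) * r)"
proof -
  obtain u where u: "u \<in> verts G"
    and ball: "\<And>w. w \<in> verts G \<Longrightarrow> \<exists>p. awalk u p w \<and> length p \<le> r"
    using radius_eqE[OF assms(1,2)] by metis
  obtain ms T where ms: "ms \<in> lists (verts G \<times> C)" "length ms = (card C - 1) * r"
    and T: "mono_connected G (fold (flood_move G) ms \<omega>) T" "u \<in> T"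
    and cover: "{w. \<exists>p. awalk u p w \<and> length p \<le> r} \<subseteq> T"
    using flood_rounds_cover_ball[OF u C] by blast
  \<comment> \<open>The target colour is whichever one \<open>u\<close> ends with.\<close>
  define d where "d = fold (flood_move G) ms \<omega> u"
  have "d \<in> C"
    unfolding d_def using fold_flood_move_colours[OF ms(1) C(2)] u by blast
  then have "min_moves G C \<omega> \<le> min_moves_to G C \<omega> d"
    unfolding min_moves_def using C(1) by (intro Min_le) auto
  also have "fold (flood_move G) ms \<omega> v = d" if "v \<in> verts G" for v
    using T cover ball[OF that] unfolding d_def mono_connected_def by blast
  then have "min_moves_to G C \<omega> d \<le> enat (length ms)"
    unfolding min_moves_to_def using ms(1) by (intro INF_lower) auto
  finally show ?thesis by (simp add: ms(2))
qed

end

text \<open>Invert an injection \<open>g\<close> from \<open>B\<close> into \<open>A\<close>, and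
  send the points outside its range to a fixed \<open>b\<close>.\<close>

lemma ex_surj_PiE:
  assumes "finite A" "finite B" "B \<noteq> {}" "card B \<le> card A"
  shows "\<exists>f \<in> A \<rightarrow>\<^sub>E B. f ` A = B"
proof -
  obtain g where g: "g ` B \<subseteq> A" "inj_on g B"
    using assms card_le_inj[of B A] by blast
  from assms obtain b where b: "b \<in> B" by blast
  define f where "f = restrict (\<lambda>x. if x \<in> g ` B then the_inv_into B g x else b) A"
  have "f \<in> A \<rightarrow>\<^sub>E B"
    using g b by (auto simp: f_def the_inv_into_f_f)
  moreover have "y \<in> f ` A" if "y \<in> B" for y
    using that g by (intro image_eqI[of _ _ "g y"]) (auto simp: f_def the_inv_into_f_f)
  ultimately show ?thesis by (intro bexI[of _ f]) auto
qed

theorem corollary2p12: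
  fixes G :: "('a, 'b) pre_digraph" and c r :: nat
  assumes "graph G"
    and "Digraph_Component.connected G"
    and "radius G = enat r"
    and "1 \<le> c" and "c \<le> card (verts G)"
  shows "max_min_moves c G \<le> enat ((c - 1) * r)"
proof -
  interpret graph G by fact
  have nonempty: "verts G \<noteq> {}" using assms(4,5) by auto
  let ?W = "{\<omega> \<in> verts G \<rightarrow>\<^sub>E {1..c}. \<omega> ` verts G = {1..c}}"
  have "finite ?W" by (simp add: finite_PiE)
  \<comment> \<open>A bound on all members bounds \<open>Max\<close> only if there is a member: at
    least \<open>c\<close> vertices guarantee a surjective colouring.\<close>
  moreover have "?W \<noteq> {}"
    using ex_surj_PiE[of "verts G" "{1..c}"] assms(4,5) by auto
  moreover have "min_moves G {1..c} \<omega> \<le> enat ((c - 1) * r)" if "\<omega> \<in> ?W" for \<omega>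
    using min_moves_le[OF nonempty assms(3), of "{1..c}" \<omega>] that by auto
  ultimately show ?thesis
    unfolding max_min_moves_def by simp
qed

end
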